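(* Let $(X,+,\circ)$ be a skew brace and let $\sigma^f_a,\tau^f_b:X\to X$ ($a,b\in X$) be such that $a\circ b=\sigma^f_a(b)\circ\tau^f_b(a)$ and each $\sigma^f_a$ is a bijection. Let also $(X,\bullet)$ be a magma with $a\bullet b=b\bullet(b\triangleright a)$, and suppose that for all $a,b\in X$, $a\circ(\sigma^f_a)^{-1}(b)=a\bullet b$. Assume also that $f:X\to X$ is a bijection such that $f(a-b+c)=f(a)-f(b)+f(c)$ for all $a,b,c\in X$. (i) If the operations $\bullet=\bullet_s$ and $\triangleright=\triangleright_s$ and the map $f$ satisfy, for all $a,b\in X$, (1) $a\bullet_s b=f(a)+b$, (2) $b\triangleright_s a=-f(b)+f(a)+b$ and (3) $f(a\circ b)=a\circ f(b)-a+f(a)$, then for all $a,b,c\in X$: a. $\sigma^f_a(b)=-f(a)+a\circ b$. b. $b\triangleright_s a=\sigma^f_b\big(\tau^f_{(\sigma^f_a)^{-1}(b)}(a)\big)$. c. $\sigma^f_a(b)\triangleright_s\sigma^f_a(c)=\sigma^f_a(b\triangleright_s c)$. d. $\sigma^f_a(\sigma^f_b(c))=\sigma^f_{a\circ b}(c)$ and $\tau^f_c(\tau^f_b(a))=\tau^{f^2}_{b\circ c}(a)$. e. $\sigma^f_a(b)\bullet_s\sigma^f_a(c)=\sigma^{f^2}_a(b\bullet_s c)$. (ii) If the operations $\bullet=\bullet_r$ and $\triangleright=\triangleright_r$ and the map $f$ satisfy, for all $a,b\in X$, (1) $a\bullet_r b=b+f(a)$, (2) $b\triangleright_r a=b+f(a)-f(b)$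 and (3) $f(a\circ b)=f(a)-a+a\circ f(b)$, then for all $a,b,c\in X$: a. $\sigma^f_a(b)=a\circ b-f(a)$. b. $b\triangleright_r a=\sigma^f_b\big(\tau^f_{(\sigma^f_a)^{-1}(b)}(a)\big)$. c. $\sigma^f_a(b)\triangleright_r\sigma^f_a(c)=\sigma^f_a(b\triangleright_r c)$. d. $\sigma^f_a(\sigma^f_b(c))=\sigma^f_{a\circ b}(c)$ and $\tau^f_c(\tau^f_b(a))=\tau^{f^2}_{b\circ c}(a)$. e. $\sigma^f_a(b)\bullet_r\sigma^f_a(c)=\sigma^{f^2}_a(b\bullet_r c)$.
   Context: A left skew brace is a set $B$ with two group operations $+,\circ$ such that $a\circ(b+c)=a\circ b-a+a\circ c$ for all $a,b,c\in B$; a skew brace (in this paper) is a left skew brace that also satisfies $(b+c)\circ a=b\circ a-a+c\circ a$ for all $a,b,c$. The group $(B,+)$ need not be abelian; the identities of $+$ and $\circ$ coincide. Inverses with respect to $\circ$ are written $x^{-1}$. $f^2=f\circ f$ (composition). $\sigma^{f^2}$ and $\tau^{f^2}$ are given by the same formulas as $\sigma^f,\tau^f$ with $f$ replaced by $f^2$: in case (i) $\sigma^{f^2}_a(b)=-f^2(a)+a\circ b$, in case (ii) $\sigma^{f^2}_a(b)=a\circ b-f^2(a)$, and in both cases $\tau^{f^2}_b(a)=(\sigma^{f^2}_a(b))^{-1}\circ a\circ b$. *)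

theory Defs
  imports Main
begin

text \<open>
  The additive group is the ambient type: class \<^class>\<open>group_add\<close> does not assume commutativity,
  and \<open>a - b\<close> is \<open>a + (- b)\<close>.  The multiplicative group has its own identity \<open>e\<close>;
  that it equals \<open>0\<close> is a consequence.
\<close>

locale left_skew_brace = group circ e cinv
  for circ :: "'a::group_add \<Rightarrow> 'a \<Rightarrow> 'a" (infixl "\<odot>" 75)
    and e :: 'a and cinv :: "'a \<Rightarrow> 'a" +
  assumes circ_add_left: "a \<odot> (b + c) = a \<odot> b - a + a \<odot> c"
begin

lemma unit_eq_zero: "e = 0"
  using circ_add_left[of e 0 0] by (simp add: group_left_neutral)

end

text \<open>Skew braces are two-sided here.\<close>

locale skew_brace = left_skew_brace +
  assumes circ_add_right: "(b + c) \<odot> a = b \<odot> a - a + c \<odot> a"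

text \<open>
  The maps \<open>\<sigma>\<^sup>g\<^sub>a(b)\<close>, for a map \<open>g\<close>, in the two cases, and the map
  \<open>\<tau>\<^sub>b(a)\<close> (subscript first) belonging to a given \<open>\<sigma>\<close>.
\<close>

definition sigma_s :: "('a::group_add \<Rightarrow> 'a \<Rightarrow> 'a) \<Rightarrow> ('a \<Rightarrow> 'a) \<Rightarrow> 'a \<Rightarrow> 'a \<Rightarrow> 'a" where
  "sigma_s circ g a b = - g a + circ a b"

definition sigma_r :: "('a::group_add \<Rightarrow> 'a \<Rightarrow> 'a) \<Rightarrow> ('a \<Rightarrow> 'a) \<Rightarrow> 'a \<Rightarrow> 'a \<Rightarrow> 'a" where
  "sigma_r circ g a b = circ a b - g a"

definition tau_of ::
    "('a \<Rightarrow> 'a \<Rightarrow> 'a) \<Rightarrow> ('a \<Rightarrow> 'a) \<Rightarrow> ('a \<Rightarrow> 'a \<Rightarrow> 'a) \<Rightarrow> 'a \<Rightarrow> 'a \<Rightarrow> 'a" where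
  "tau_of circ cinv sigma b a = circ (circ (cinv (sigma a b)) a) b"

end

theory Submission
  imports Defs
begin

text \<open>
  The formula for \<open>\<sigma>\<close> is the hypothesis on \<open>inv (\<sigma> a)\<close> read at a point \<open>\<sigma> a c\<close>.  The rest is a
  computation in the noncommutative group \<open>+\<close>, carried by three facts.  The twist law below is the
  assumed formula for \<open>f (circ a b)\<close>.

  First, \<open>x \<mapsto> - a + circ a x\<close> is additive, so \<open>circ a\<close> can be pushed through every sum and
  difference in the theorem (\<open>circ_uminus\<close>, \<open>circ_diff\<close>, \<open>circ_uminus_add\<close>).

  Second, the twist law at \<open>0\<close> forces \<open>f 0 = 0\<close>.  Hence the affine map \<open>f\<close> is additive and turns the
  translation by \<open>f a\<close> in \<open>\<sigma> a b\<close> into a translation by \<open>f (f a)\<close>; this is where \<open>f \<circ> f\<close> comes from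
  (\<open>f_sigma_s\<close>, \<open>f_sigma_r\<close>).

  Third, if \<open>circ a b = circ x y\<close> with \<open>x = \<sigma> a b\<close> and \<open>y = \<tau> b a\<close>, then the twist law for
  \<open>circ x y\<close> expresses \<open>circ x (f y)\<close> by \<open>f (circ a b)\<close> and \<open>f x\<close>.  It follows that
  \<open>circ x (\<sigma> y c)\<close> is the \<open>f \<circ> f\<close>-version of \<open>\<sigma>\<close> at \<open>a\<close> and \<open>circ b c\<close> (\<open>circ_sigma_s\<close>,
  \<open>circ_sigma_r\<close>), and cancelling this factor in the group \<open>circ\<close> gives the identity for \<open>\<tau>\<close>
  (\<open>tau_tau_eq_tau_of\<close>).

  The two cases are mirror images: reversing the order of all sums turns one into the other.  Addition
  is the ambient operation of the type, so each case is computed separately.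
\<close>

section \<open>Left skew braces\<close>

context left_skew_brace
begin

lemma cinv_circ_cancel: "cinv a \<odot> (a \<odot> b) = b"
  by (metis assoc group_left_neutral left_inverse)

lemma circ_zero_right: "a \<odot> 0 = a"
  using right_neutral unit_eq_zero by metis

lemma circ_uminus: "a \<odot> (- x) = a - a \<odot> x + a"
proof -
  have "a = a \<odot> x - a + a \<odot> (- x)"
    using circ_add_left[of a x "- x"] by (simp add: circ_zero_right)
  then have "- (a \<odot> x - a) + a = a \<odot> (- x)"
    by (metis minus_add_cancel)
  then show ?thesis by simp
qed

lemma circ_diff: "a \<odot> (x - y) = a \<odot> x - a \<odot> y + a"
  using circ_add_left[of a x "- y"]
  by (simp add: circ_uminus add.assoc minus_add diff_conv_add_uminus del: add_uminus_conv_diff)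

lemma circ_uminus_add: "a \<odot> (- x + y) = a - a \<odot> x + a \<odot> y"
  by (simp add: circ_add_left circ_uminus)

text \<open>
  This transfers identities for \<open>\<sigma>\<close> to \<open>\<tau>\<close>.  Both sides are right factors in a
  factorisation of \<open>a \<odot> b \<odot> c\<close>, so they agree as soon as the left factors do.
\<close>

lemma tau_tau_eq_tau_of:
  assumes fac: "\<And>a b. a \<odot> b = \<sigma> a b \<odot> \<tau> b a"
    and "\<sigma> a b \<odot> \<sigma> (\<tau> b a) c = \<rho> a (b \<odot> c)"
  shows "\<tau> c (\<tau> b a) = tau_of (\<odot>) cinv \<rho> (b \<odot> c) a"
proof -
  have "a \<odot> (b \<odot> c) = \<sigma> a b \<odot> (\<tau> b a \<odot> c)"
    by (metis assoc fac)
  also have "\<dots> = \<rho> a (b \<odot> c) \<odot> \<tau> c (\<tau> b a)"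
    by (metis assms assoc)
  finally show ?thesis
    by (simp add: tau_of_def assoc cinv_circ_cancel)
qed

end

section \<open>The left translated case\<close>

locale left_twist = left_skew_brace circ e cinv
  for circ :: "'a::group_add \<Rightarrow> 'a \<Rightarrow> 'a" (infixl "\<odot>" 75)
    and e :: 'a and cinv :: "'a \<Rightarrow> 'a" +
  fixes f :: "'a \<Rightarrow> 'a"
  assumes affine: "f (a - b + c) = f a - f b + f c"
    and twist: "f (a \<odot> b) = a \<odot> f b - a + f a"
begin

abbreviation "\<sigma>f \<equiv> sigma_s (\<odot>) f"
abbreviation "\<sigma>ff \<equiv> sigma_s (\<odot>) (f \<circ> f)"

lemma f_zero: "f 0 = 0"
proof -
  have "f 0 + f 0 = f 0 + 0"
    using twist[of 0 0] group_left_neutral unit_eq_zero by simp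
  then show ?thesis by (rule add_left_imp_eq)
qed

lemma f_sigma_s: "f (\<sigma>f a b) = - f (f a) + f (a \<odot> b)"
  using affine[of 0 "f a" "a \<odot> b"] by (simp add: sigma_s_def f_zero)

text \<open>
  Each \<open>\<sigma>f a\<close> respects the operation \<open>- f b + f c + b\<close>: the translation by \<open>f (f a)\<close> cancels between
  the first two summands, and what remains is \<open>a \<odot> _\<close> applied to \<open>f c\<close>, \<open>f b\<close> and \<open>b\<close>.
\<close>

lemma sigma_s_conj:
  "- f (\<sigma>f a b) + f (\<sigma>f a c) + \<sigma>f a b = \<sigma>f a (- f b + f c + b)"
proof -
  have "- f (\<sigma>f a b) + f (\<sigma>f a c) = - f a + (a - a \<odot> f b + a \<odot> f c) - a + f a"
    unfolding f_sigma_s twist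
    by (simp add: add.assoc minus_add diff_conv_add_uminus del: add_uminus_conv_diff)
  then have "- f (\<sigma>f a b) + f (\<sigma>f a c) + \<sigma>f a b
      = - f a + (a \<odot> (- f b + f c) - a + a \<odot> b)"
    unfolding circ_uminus_add sigma_s_def
    by (simp add: add.assoc minus_add diff_conv_add_uminus del: add_uminus_conv_diff)
  then show ?thesis
    by (simp add: sigma_s_def circ_add_left)
qed

text \<open>
  Both sides are left translates of \<open>a \<odot> b \<odot> c\<close>, and the twist law is what makes the translating
  elements equal.
\<close>

lemma sigma_s_hom: "\<sigma>f a (\<sigma>f b c) = \<sigma>f (a \<odot> b) c"
  unfolding sigma_s_def twist circ_uminus_add assoc
  by (simp add: add.assoc minus_add diff_conv_add_uminus del: add_uminus_conv_diff)

text \<open>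
  Put \<open>x = \<sigma>f a b\<close>.  The product \<open>x \<odot> \<sigma>f y c\<close> is a left translate of
  \<open>x \<odot> y \<odot> c = a \<odot> b \<odot> c\<close>.  The twist law for \<open>x \<odot> y\<close> writes the translating element as a
  difference of \<open>f x\<close> and \<open>f (a \<odot> b)\<close>, and these differ by \<open>f (f a)\<close>.
\<close>

lemma circ_sigma_s:
  assumes "a \<odot> b = \<sigma>f a b \<odot> y"
  shows "\<sigma>f a b \<odot> \<sigma>f y c = \<sigma>ff a (b \<odot> c)"
proof -
  define x where "x = \<sigma>f a b"
  have xy: "x \<odot> y = a \<odot> b" using assms by (simp add: x_def)
  have "x - x \<odot> f y = f x - f (x \<odot> y)"
    unfolding twist
    by (simp add: add.assoc minus_add diff_conv_add_uminus del: add_uminus_conv_diff)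
  also have "\<dots> = - f (f a)"
    unfolding xy by (simp add: x_def f_sigma_s)
  finally have "x - x \<odot> f y = - f (f a)" .
  then have "x \<odot> \<sigma>f y c = - f (f a) + x \<odot> (y \<odot> c)"
    by (simp add: sigma_s_def circ_uminus_add)
  also have "x \<odot> (y \<odot> c) = a \<odot> (b \<odot> c)"
    by (metis assoc xy)
  finally show ?thesis by (simp add: x_def sigma_s_def)
qed

text \<open>
  The two summands on the left meet in \<open>f a\<close> and \<open>- f a\<close>, which cancel; only the translation by
  \<open>f (f a)\<close> survives.
\<close>

lemma sigma_s_translate: "f (\<sigma>f a b) + \<sigma>f a c = \<sigma>ff a (f b + c)"
  unfolding f_sigma_s twist
  by (simp add: sigma_s_def circ_add_left add.assoc minus_add diff_conv_add_uminus
      del: add_uminus_conv_diff)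

end

section \<open>The right translated case\<close>

locale right_twist = left_skew_brace circ e cinv
  for circ :: "'a::group_add \<Rightarrow> 'a \<Rightarrow> 'a" (infixl "\<odot>" 75)
    and e :: 'a and cinv :: "'a \<Rightarrow> 'a" +
  fixes f :: "'a \<Rightarrow> 'a"
  assumes affine: "f (a - b + c) = f a - f b + f c"
    and twist: "f (a \<odot> b) = f a - a + a \<odot> f b"
begin

abbreviation "\<sigma>f \<equiv> sigma_r (\<odot>) f"
abbreviation "\<sigma>ff \<equiv> sigma_r (\<odot>) (f \<circ> f)"

lemma f_zero: "f 0 = 0"
proof -
  have "f 0 + f 0 = f 0 + 0"
    using twist[of 0 0] group_left_neutral unit_eq_zero by simp
  then show ?thesis by (rule add_left_imp_eq)
qed

lemma f_sigma_r: "f (\<sigma>f a b) = f (a \<odot> b) - f (f a)"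
  using affine[of "a \<odot> b" "f a" 0] by (simp add: sigma_r_def f_zero)

text \<open>The translation by \<open>f (f a)\<close> now cancels between the last two summands.\<close>

lemma sigma_r_conj:
  "\<sigma>f a b + f (\<sigma>f a c) - f (\<sigma>f a b) = \<sigma>f a (b + f c - f b)"
  unfolding f_sigma_r twist
  by (simp add: sigma_r_def circ_add_left circ_uminus add.assoc minus_add diff_conv_add_uminus
      del: add_uminus_conv_diff)

lemma sigma_r_hom: "\<sigma>f a (\<sigma>f b c) = \<sigma>f (a \<odot> b) c"
  unfolding sigma_r_def twist circ_diff assoc
  by (simp add: add.assoc minus_add diff_conv_add_uminus del: add_uminus_conv_diff)

text \<open>
  Put \<open>x = \<sigma>f a b\<close>.  The product \<open>x \<odot> \<sigma>f y c\<close> is a right translate of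
  \<open>x \<odot> y \<odot> c = a \<odot> b \<odot> c\<close>.  The twist law for \<open>x \<odot> y\<close> writes the translating element as a
  difference of \<open>f x\<close> and \<open>f (a \<odot> b)\<close>, and these differ by \<open>f (f a)\<close>.
\<close>

lemma circ_sigma_r:
  assumes "a \<odot> b = \<sigma>f a b \<odot> y"
  shows "\<sigma>f a b \<odot> \<sigma>f y c = \<sigma>ff a (b \<odot> c)"
proof -
  define x where "x = \<sigma>f a b"
  have xy: "x \<odot> y = a \<odot> b" using assms by (simp add: x_def)
  have "- (x \<odot> f y) + x = - f (x \<odot> y) + f x"
    unfolding twist
    by (simp add: add.assoc minus_add diff_conv_add_uminus del: add_uminus_conv_diff)
  also have "\<dots> = - f (f a)"
    unfolding xy by (simp add: x_def f_sigma_r diff_conv_add_uminus del: add_uminus_conv_diff)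
  finally have *: "- (x \<odot> f y) + x = - f (f a)" .
  have "x \<odot> \<sigma>f y c = x \<odot> (y \<odot> c) + (- (x \<odot> f y) + x)"
    by (simp add: sigma_r_def circ_add_left circ_uminus add.assoc diff_conv_add_uminus
        del: add_uminus_conv_diff)
  also have "\<dots> = x \<odot> (y \<odot> c) - f (f a)"
    unfolding * by simp
  also have "x \<odot> (y \<odot> c) = a \<odot> (b \<odot> c)"
    by (metis assoc xy)
  finally show ?thesis by (simp add: x_def sigma_r_def)
qed

text \<open>
  The two summands on the left meet in \<open>f a\<close> and \<open>- f a\<close>, which cancel; only the translation by
  \<open>f (f a)\<close> survives.
\<close>

lemma sigma_r_translate: "\<sigma>f a c + f (\<sigma>f a b) = \<sigma>ff a (c + f b)"
  unfolding f_sigma_r twist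
  by (simp add: sigma_r_def circ_add_left add.assoc minus_add diff_conv_add_uminus
      del: add_uminus_conv_diff)

end

section \<open>The self-distributive operation and the braiding maps\<close>

theorem proposition5p27:
  fixes circ :: "'a::group_add \<Rightarrow> 'a \<Rightarrow> 'a" (infixl "\<odot>" 75)
    and e :: 'a
    and cinv :: "'a \<Rightarrow> 'a"
    and \<sigma> :: "'a \<Rightarrow> 'a \<Rightarrow> 'a"
    and \<tau> :: "'a \<Rightarrow> 'a \<Rightarrow> 'a"
    and bullet :: "'a \<Rightarrow> 'a \<Rightarrow> 'a" (infixl "\<bullet>" 70)
    and tri :: "'a \<Rightarrow> 'a \<Rightarrow> 'a" (infixl "\<triangleright>" 70)
    and f :: "'a \<Rightarrow> 'a"
  assumes "skew_brace (\<odot>) e cinv"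
    and "\<And>a b. a \<odot> b = \<sigma> a b \<odot> \<tau> b a"
    and "\<And>a. bij (\<sigma> a)"
    and "\<And>a b. a \<bullet> b = b \<bullet> (b \<triangleright> a)"
    and "\<And>a b. a \<odot> inv (\<sigma> a) b = a \<bullet> b"
    and "bij f"
    and "\<And>a b c. f (a - b + c) = f a - f b + f c"
  shows
    "((\<forall>a b. a \<bullet> b = f a + b) \<and>
      (\<forall>a b. b \<triangleright> a = - f b + f a + b) \<and>
      (\<forall>a b. f (a \<odot> b) = a \<odot> f b - a + f a) \<longrightarrow>
      (\<forall>a b c.
         \<sigma> a b = - f a + a \<odot> b \<and>
         b \<triangleright> a = \<sigma> b (\<tau> (inv (\<sigma> a) b) a) \<and>
         \<sigma> a b \<triangleright> \<sigma> a c = \<sigma> a (b \<triangleright> c) \<and>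
         (\<sigma> a (\<sigma> b c) = \<sigma> (a \<odot> b) c \<and>
          \<tau> c (\<tau> b a) = tau_of (\<odot>) cinv (sigma_s (\<odot>) (f \<circ> f)) (b \<odot> c) a) \<and>
         \<sigma> a b \<bullet> \<sigma> a c = sigma_s (\<odot>) (f \<circ> f) a (b \<bullet> c)))
     \<and>
     ((\<forall>a b. a \<bullet> b = b + f a) \<and>
      (\<forall>a b. b \<triangleright> a = b + f a - f b) \<and>
      (\<forall>a b. f (a \<odot> b) = f a - a + a \<odot> f b) \<longrightarrow>
      (\<forall>a b c.
         \<sigma> a b = a \<odot> b - f a \<and>
         b \<triangleright> a = \<sigma> b (\<tau> (inv (\<sigma> a) b) a) \<and>
         \<sigma> a b \<triangleright> \<sigma> a c = \<sigma> a (b \<triangleright> c) \<and>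
         (\<sigma> a (\<sigma> b c) = \<sigma> (a \<odot> b) c \<and>
          \<tau> c (\<tau> b a) = tau_of (\<odot>) cinv (sigma_r (\<odot>) (f \<circ> f)) (b \<odot> c) a) \<and>
         \<sigma> a b \<bullet> \<sigma> a c = sigma_r (\<odot>) (f \<circ> f) a (b \<bullet> c)))"
proof (rule conjI; rule impI)
  assume hyp: "(\<forall>a b. a \<bullet> b = f a + b) \<and>
    (\<forall>a b. b \<triangleright> a = - f b + f a + b) \<and>
    (\<forall>a b. f (a \<odot> b) = a \<odot> f b - a + f a)"
  then have bullet: "\<And>a b. a \<bullet> b = f a + b" and tri: "\<And>a b. b \<triangleright> a = - f b + f a + b"
    by blast+
  interpret left_twist "(\<odot>)" e cinv f
    using hyp assms(7)
    by (intro left_twist.intro left_twist_axioms.intro skew_brace.axioms(1)[OF assms(1)]) blast+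
  have "a \<odot> c = f a + \<sigma> a c" for a c
    using assms(5)[of a "\<sigma> a c"] bij_is_inj[OF assms(3)] by (simp add: bullet)
  then have sigma: "\<sigma> = sigma_s (\<odot>) f"
    by (intro ext) (simp add: sigma_s_def)
  have act: "b \<triangleright> a = \<sigma> b (\<tau> (inv (\<sigma> a) b) a)" for a b
  proof -
    have "\<sigma> a (inv (\<sigma> a) b) = b"
      using bij_is_surj[OF assms(3)] by (rule surj_f_inv_f)
    then have "b \<odot> \<tau> (inv (\<sigma> a) b) a = a \<bullet> b"
      using assms(2)[of a "inv (\<sigma> a) b"] assms(5)[of a b] by simp
    then have "sigma_s (\<odot>) f b (\<tau> (inv (\<sigma> a) b) a) = b \<triangleright> a"
      by (simp add: sigma_s_def bullet tri add.assoc)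
    then show ?thesis by (simp add: sigma)
  qed
  have tau: "\<tau> c (\<tau> b a) = tau_of (\<odot>) cinv (sigma_s (\<odot>) (f \<circ> f)) (b \<odot> c) a" for a b c
    using assms(2) by (rule tau_tau_eq_tau_of) (use assms(2) in \<open>simp add: sigma circ_sigma_s\<close>)
  show "(\<forall>a b c.
        \<sigma> a b = - f a + a \<odot> b \<and>
        b \<triangleright> a = \<sigma> b (\<tau> (inv (\<sigma> a) b) a) \<and>
        \<sigma> a b \<triangleright> \<sigma> a c = \<sigma> a (b \<triangleright> c) \<and>
        (\<sigma> a (\<sigma> b c) = \<sigma> (a \<odot> b) c \<and>
         \<tau> c (\<tau> b a) = tau_of (\<odot>) cinv (sigma_s (\<odot>) (f \<circ> f)) (b \<odot> c) a) \<and>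
        \<sigma> a b \<bullet> \<sigma> a c = sigma_s (\<odot>) (f \<circ> f) a (b \<bullet> c))"
  proof (intro allI conjI)
    fix a b c
    show "\<sigma> a b = - f a + a \<odot> b"
      by (simp add: sigma sigma_s_def)
    show "b \<triangleright> a = \<sigma> b (\<tau> (inv (\<sigma> a) b) a)"
      by (rule act)
    show "\<sigma> a b \<triangleright> \<sigma> a c = \<sigma> a (b \<triangleright> c)"
      unfolding tri sigma by (rule sigma_s_conj)
    show "\<sigma> a (\<sigma> b c) = \<sigma> (a \<odot> b) c"
      unfolding sigma by (rule sigma_s_hom)
    show "\<tau> c (\<tau> b a) = tau_of (\<odot>) cinv (sigma_s (\<odot>) (f \<circ> f)) (b \<odot> c) a"
      by (rule tau)
    show "\<sigma> a b \<bullet> \<sigma> a c = sigma_s (\<odot>) (f \<circ> f) a (b \<bullet> c)"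
      unfolding bullet sigma by (rule sigma_s_translate)
  qed
next
  assume hyp: "(\<forall>a b. a \<bullet> b = b + f a) \<and>
    (\<forall>a b. b \<triangleright> a = b + f a - f b) \<and>
    (\<forall>a b. f (a \<odot> b) = f a - a + a \<odot> f b)"
  then have bullet: "\<And>a b. a \<bullet> b = b + f a" and tri: "\<And>a b. b \<triangleright> a = b + f a - f b"
    by blast+
  interpret right_twist "(\<odot>)" e cinv f
    using hyp assms(7)
    by (intro right_twist.intro right_twist_axioms.intro skew_brace.axioms(1)[OF assms(1)]) blast+
  have "a \<odot> c = \<sigma> a c + f a" for a c
    using assms(5)[of a "\<sigma> a c"] bij_is_inj[OF assms(3)] by (simp add: bullet)
  then have sigma: "\<sigma> = sigma_r (\<odot>) f"
    by (intro ext) (simp add: sigma_r_def)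
  have act: "b \<triangleright> a = \<sigma> b (\<tau> (inv (\<sigma> a) b) a)" for a b
  proof -
    have "\<sigma> a (inv (\<sigma> a) b) = b"
      using bij_is_surj[OF assms(3)] by (rule surj_f_inv_f)
    then have "b \<odot> \<tau> (inv (\<sigma> a) b) a = a \<bullet> b"
      using assms(2)[of a "inv (\<sigma> a) b"] assms(5)[of a b] by simp
    then have "sigma_r (\<odot>) f b (\<tau> (inv (\<sigma> a) b) a) = b \<triangleright> a"
      by (simp add: sigma_r_def bullet tri add.assoc)
    then show ?thesis by (simp add: sigma)
  qed
  have tau: "\<tau> c (\<tau> b a) = tau_of (\<odot>) cinv (sigma_r (\<odot>) (f \<circ> f)) (b \<odot> c) a" for a b c
    using assms(2) by (rule tau_tau_eq_tau_of) (use assms(2) in \<open>simp add: sigma circ_sigma_r\<close>)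
  show "(\<forall>a b c.
        \<sigma> a b = a \<odot> b - f a \<and>
        b \<triangleright> a = \<sigma> b (\<tau> (inv (\<sigma> a) b) a) \<and>
        \<sigma> a b \<triangleright> \<sigma> a c = \<sigma> a (b \<triangleright> c) \<and>
        (\<sigma> a (\<sigma> b c) = \<sigma> (a \<odot> b) c \<and>
         \<tau> c (\<tau> b a) = tau_of (\<odot>) cinv (sigma_r (\<odot>) (f \<circ> f)) (b \<odot> c) a) \<and>
        \<sigma> a b \<bullet> \<sigma> a c = sigma_r (\<odot>) (f \<circ> f) a (b \<bullet> c))"
  proof (intro allI conjI)
    fix a b c
    show "\<sigma> a b = a \<odot> b - f a"
      by (simp add: sigma sigma_r_def)
    show "b \<triangleright> a = \<sigma> b (\<tau> (inv (\<sigma> a) b) a)"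
      by (rule act)
    show "\<sigma> a b \<triangleright> \<sigma> a c = \<sigma> a (b \<triangleright> c)"
      unfolding tri sigma by (rule sigma_r_conj)
    show "\<sigma> a (\<sigma> b c) = \<sigma> (a \<odot> b) c"
      unfolding sigma by (rule sigma_r_hom)
    show "\<tau> c (\<tau> b a) = tau_of (\<odot>) cinv (sigma_r (\<odot>) (f \<circ> f)) (b \<odot> c) a"
      by (rule tau)
    show "\<sigma> a b \<bullet> \<sigma> a c = sigma_r (\<odot>) (f \<circ> f) a (b \<bullet> c)"
      unfolding bullet sigma by (rule sigma_r_translate)
  qed
qed

end
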